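(* The Poisson Conjecture $\mathrm{PC}(n)$ is false for every integer $n\ge 2$; that is, for every $n\geq 2$ there exists a Poisson endomorphism of $\mathcal P_n$ that is not an automorphism.
   Context: For a positive integer $n$, $\mathcal P_n=\mathbb C[x_1,\dots,x_n,p_1,\dots,p_n]$ is the polynomial algebra in $2n$ variables with the canonical Poisson bracket $$\{f,g\}=\sum_{i=1}^n\left(\frac{\partial f}{\partial p_i}\frac{\partial g}{\partial x_i}-\frac{\partial f}{\partial x_i}\frac{\partial g}{\partial p_i}\right).$$ A Poisson endomorphism of $\mathcal P_n$ is a $\mathbb C$-algebra endomorphism $\Phi$ with $\Phi(\{f,g\})=\{\Phi(f),\Phi(g)\}$ for all $f,g\in\mathcal P_n$. $\mathrm{PC}(n)$ is the assertion that every Poisson endomorphism of $\mathcal P_n$ is an automorphism. *)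

theory Defs
  imports Complex_Main "HOL-Library.Poly_Mapping"
begin

datatype pvar = Xvar nat | Pvar nat

text \<open>
  Polynomials over the complex numbers in the variables \<open>Xvar i\<close>, \<open>Pvar i\<close> are finitely supported
  maps from monomials (finitely supported exponent maps) to coefficients; the ring structure is
  the convolution ring of \<^theory>\<open>HOL-Library.Poly_Mapping\<close>. The algebra in \<open>2 * n\<close> variables is
  the subring \<open>poisson_carrier n\<close> of polynomials involving only \<open>Xvar i\<close>, \<open>Pvar i\<close> with
  \<open>1 \<le> i \<le> n\<close>.
\<close>

type_synonym cpoly = "(pvar \<Rightarrow>\<^sub>0 nat) \<Rightarrow>\<^sub>0 complex"

definition Const :: "complex \<Rightarrow> cpoly" where
  "Const c = Poly_Mapping.single 0 c"

definition Var :: "pvar \<Rightarrow> cpoly" where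
  "Var v = Poly_Mapping.single (Poly_Mapping.single v 1) 1"

definition poisson_carrier :: "nat \<Rightarrow> cpoly set" where
  "poisson_carrier n =
     {f. \<forall>m \<in> Poly_Mapping.keys f. Poly_Mapping.keys m \<subseteq> Xvar ` {1..n} \<union> Pvar ` {1..n}}"

text \<open>
  Subtraction of exponents is truncated, but a monomial not containing \<open>v\<close> contributes with
  coefficient \<open>0\<close>.
\<close>

definition partial :: "pvar \<Rightarrow> cpoly \<Rightarrow> cpoly" where
  "partial v f =
     (\<Sum>m \<in> Poly_Mapping.keys f.
        Poly_Mapping.single (m - Poly_Mapping.single v 1)
          (of_nat (Poly_Mapping.lookup m v) * Poly_Mapping.lookup f m))"

definition poisson_bracket :: "nat \<Rightarrow> cpoly \<Rightarrow> cpoly \<Rightarrow> cpoly" where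
  "poisson_bracket n f g =
     (\<Sum>i = 1..n. partial (Pvar i) f * partial (Xvar i) g - partial (Xvar i) f * partial (Pvar i) g)"

text \<open>
  Maps on the carrier are total functions of which only the values on \<open>poisson_carrier n\<close> matter.
  Fixing all constants amounts to being unital and complex-linear, given the other conditions.
\<close>

definition algebra_endomorphism :: "nat \<Rightarrow> (cpoly \<Rightarrow> cpoly) \<Rightarrow> bool" where
  "algebra_endomorphism n \<Phi> \<longleftrightarrow>
     (\<forall>f \<in> poisson_carrier n. \<Phi> f \<in> poisson_carrier n) \<and>
     (\<forall>c. \<Phi> (Const c) = Const c) \<and>
     (\<forall>f \<in> poisson_carrier n. \<forall>g \<in> poisson_carrier n. \<Phi> (f + g) = \<Phi> f + \<Phi> g) \<and>
     (\<forall>f \<in> poisson_carrier n. \<forall>g \<in> poisson_carrier n. \<Phi> (f * g) = \<Phi> f * \<Phi> g)"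

definition poisson_endomorphism :: "nat \<Rightarrow> (cpoly \<Rightarrow> cpoly) \<Rightarrow> bool" where
  "poisson_endomorphism n \<Phi> \<longleftrightarrow>
     algebra_endomorphism n \<Phi> \<and>
     (\<forall>f \<in> poisson_carrier n. \<forall>g \<in> poisson_carrier n.
        \<Phi> (poisson_bracket n f g) = poisson_bracket n (\<Phi> f) (\<Phi> g))"

text \<open>The inverse of a bijective endomorphism is again an endomorphism.\<close>

definition algebra_automorphism :: "nat \<Rightarrow> (cpoly \<Rightarrow> cpoly) \<Rightarrow> bool" where
  "algebra_automorphism n \<Phi> \<longleftrightarrow>
     algebra_endomorphism n \<Phi> \<and> bij_betw \<Phi> (poisson_carrier n) (poisson_carrier n)"

definition PC :: "nat \<Rightarrow> bool" where
  "PC n \<longleftrightarrow> (\<forall>\<Phi>. poisson_endomorphism n \<Phi> \<longrightarrow> algebra_automorphism n \<Phi>)"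

text \<open>The sign convention of the bracket is \<open>{p, x} = 1\<close>.\<close>

lemma partial_Var: "partial v (Var w) = (if v = w then 1 else 0)"
  by (auto simp: partial_def Var_def lookup_single single_one)

lemma poisson_bracket_Pvar_Xvar:
  assumes "i \<in> {1..n}"
  shows "poisson_bracket n (Var (Pvar i)) (Var (Xvar j)) = (if i = j then 1 else 0)"
proof -
  have "poisson_bracket n (Var (Pvar i)) (Var (Xvar j)) =
      (\<Sum>k = 1..n. if k = i then (if i = j then 1 else 0) else 0)"
    unfolding poisson_bracket_def partial_Var by (intro sum.cong) auto
  with assms show ?thesis by simp
qed

end

theory Submission
  imports Defs
begin

text \<open>
  Put \<open>s = y + x z\<close>. The polynomial map of three-space with components
  \<open>F1 = 27 z + 27 y s + 9 x y^2 s + x^2 y^3 s - 15 y^2 - 2 x y^3\<close>,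
  \<open>F2 = s (3 + x y)^2 - 8 y - 2 x y^2\<close>, \<open>F3 = 2 x - x^2 s\<close>
  has constant Jacobian determinant but is not injective. It becomes a symplectic map in
  dimension four as follows. The coordinate functions of three-space carry the Poisson structure
  in which \<open>F3\<close> is central and \<open>{F2, F1}\<close> is constant, and one adjoins a variable that is canonically
  conjugate to \<open>F3\<close> and commutes with \<open>F1\<close> and \<open>F2\<close>. In the resulting
  symplectic four-space the Hamiltonian flow of \<open>x\<close> is a free algebraic action of the
  additive group, and straightening it produces Darboux coordinates \<open>x, q, s, t\<close>: three-space
  is recovered through \<open>y = s + x^2 s^3 + x r\<close> and \<open>z = - x s^3 - r\<close> with
  \<open>r = 6 t (1 - x s) - 3 x^2 q\<close>, and the conjugate of \<open>F3\<close> is a multiple of the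
  polynomial \<open>partner\<close> below. The symmetry \<open>x, y, s \<mapsto> - x, - y, - s\<close> negates \<open>F2\<close> and \<open>F3\<close> and fixes
  \<open>F1\<close> and \<open>partner\<close>, so any point with \<open>F2 = F3 = 0\<close> and \<open>x \<noteq> 0\<close> collides with its mirror image.
\<close>

text \<open>The order on the variables only serves to make \<open>cpoly\<close> an integral domain.\<close>

instantiation pvar :: linorder
begin

fun pvar_code :: "pvar \<Rightarrow> nat" where
  "pvar_code (Xvar i) = 2 * i"
| "pvar_code (Pvar i) = 2 * i + 1"

definition less_eq_pvar :: "pvar \<Rightarrow> pvar \<Rightarrow> bool" where
  "v \<le> w \<longleftrightarrow> pvar_code v \<le> pvar_code w"

definition less_pvar :: "pvar \<Rightarrow> pvar \<Rightarrow> bool" where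
  "v < w \<longleftrightarrow> pvar_code v < pvar_code w"

lemma pvar_code_inj: "pvar_code v = pvar_code w \<Longrightarrow> v = w"
  by (cases v; cases w) (auto, presburger+)

instance
  by standard (auto simp: less_eq_pvar_def less_pvar_def intro: pvar_code_inj)

end

section \<open>Finitely supported maps as sums of monomials\<close>

lemma poly_mapping_additive_induct [case_names zero single add]:
  fixes f :: "'a \<Rightarrow>\<^sub>0 'b::comm_monoid_add"
  assumes zero: "P 0"
    and single: "\<And>m c. P (Poly_Mapping.single m c)"
    and add: "\<And>f g. P f \<Longrightarrow> P g \<Longrightarrow> P (f + g)"
  shows "P f"
proof -
  have "f = (\<Sum>m\<in>Poly_Mapping.keys f. Poly_Mapping.single m (Poly_Mapping.lookup f m))"
    by (rule poly_mapping_eqI)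
       (simp add: lookup_sum lookup_single when_def not_in_keys_iff_lookup_eq_zero flip: in_keys_iff)
  moreover have "P (\<Sum>m\<in>A. Poly_Mapping.single m (Poly_Mapping.lookup f m))" if "finite A" for A
    using that by induction (simp_all add: zero single add)
  ultimately show ?thesis by (metis finite_keys)
qed

text \<open>Cancellation can make the support of \<open>f + g\<close> smaller than the union of the
  two supports; \<open>h m 0 = 0\<close> makes the missing terms vanish. Both \<open>partial\<close>
  and \<open>subst\<close> are sums of this shape.\<close>

lemma sum_keys_add:
  fixes f g :: "'a \<Rightarrow>\<^sub>0 'b::comm_monoid_add" and h :: "'a \<Rightarrow> 'b \<Rightarrow> 'c::comm_monoid_add"
  assumes "\<And>m. h m 0 = 0" and "\<And>m b c. h m (b + c) = h m b + h m c"
  shows "(\<Sum>m\<in>Poly_Mapping.keys (f + g). h m (Poly_Mapping.lookup (f + g) m)) =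
         (\<Sum>m\<in>Poly_Mapping.keys f. h m (Poly_Mapping.lookup f m)) +
         (\<Sum>m\<in>Poly_Mapping.keys g. h m (Poly_Mapping.lookup g m))"
  by (rule setsum_keys_plus_distrib) (use assms in auto)

subsection \<open>Derivations\<close>

lemma partial_zero [simp]: "partial v 0 = 0"
  by (simp add: partial_def)

lemma partial_single:
  "partial v (Poly_Mapping.single m c) =
     Poly_Mapping.single (m - Poly_Mapping.single v 1) (of_nat (Poly_Mapping.lookup m v) * c)"
  by (simp add: partial_def)

lemma partial_add: "partial v (f + g) = partial v f + partial v g"
  unfolding partial_def by (rule sum_keys_add) (auto simp: distrib_left single_add)

lemma monomial_add_diff_left:
  "Poly_Mapping.lookup m v \<noteq> 0 \<Longrightarrow>
     m + k - Poly_Mapping.single v (1::nat) = (m - Poly_Mapping.single v 1) + k"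
  by (rule poly_mapping_eqI) (auto simp: lookup_add lookup_minus lookup_single when_def)

lemma partial_mult_single:
  "partial v (Poly_Mapping.single m c * Poly_Mapping.single k d) =
     partial v (Poly_Mapping.single m c) * Poly_Mapping.single k d +
     Poly_Mapping.single m c * partial v (Poly_Mapping.single k d)"
proof -
  \<comment> \<open>Since subtraction of exponents is truncated, the two monomials may differ when
    \<open>v\<close> does not occur in \<open>m\<close>, but then both coefficients are 0.\<close>
  have left: "Poly_Mapping.single (m + k - Poly_Mapping.single v 1) (of_nat (Poly_Mapping.lookup m v) * a) =
      Poly_Mapping.single (m - Poly_Mapping.single v 1 + k) (of_nat (Poly_Mapping.lookup m v) * a)"
    for m k :: "pvar \<Rightarrow>\<^sub>0 nat" and a :: complex
    by (cases "Poly_Mapping.lookup m v = 0") (simp_all only: monomial_add_diff_left of_nat_0 mult_zero_left single_zero not_False_eq_True)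
  show ?thesis
    using left[of m k "c * d"] left[of k m "c * d"]
    by (simp add: mult_single partial_single lookup_add distrib_left distrib_right single_add
        ac_simps)
qed

lemma partial_mult: "partial v (f * g) = partial v f * g + f * partial v g"
proof (induction f rule: poly_mapping_additive_induct)
  case (single m c)
  show ?case
    by (induction g rule: poly_mapping_additive_induct)
       (simp_all add: partial_mult_single partial_add distrib_left)
qed (simp_all add: partial_add distrib_right)

lemma partial_Const: "partial v (Const c) = 0"
  by (simp add: Const_def partial_single)

lemma Const_hom:
  "Const 0 = 0" "Const 1 = 1" "Const (numeral k) = numeral k"
  "Const (a + b) = Const a + Const b" "Const (a * b) = Const a * Const b"
  by (simp_all add: Const_def single_add mult_single)

lemma Const_inject: "Const a = Const b \<longleftrightarrow> a = b"
  unfolding Const_def by (rule inj_eq) (rule inj_single)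

section \<open>The Poisson bracket as a biderivation\<close>

lemma poisson_bracket_add:
  "poisson_bracket n (f + g) h = poisson_bracket n f h + poisson_bracket n g h"
  "poisson_bracket n h (f + g) = poisson_bracket n h f + poisson_bracket n h g"
  by (simp_all add: poisson_bracket_def partial_add algebra_simps flip: sum.distrib)

lemma poisson_bracket_mult:
  "poisson_bracket n (f * g) h = f * poisson_bracket n g h + g * poisson_bracket n f h"
  "poisson_bracket n h (f * g) = f * poisson_bracket n h g + g * poisson_bracket n h f"
  by (simp_all add: poisson_bracket_def partial_mult sum_distrib_left algebra_simps flip: sum.distrib)

lemma poisson_bracket_Const:
  "poisson_bracket n (Const c) h = 0" "poisson_bracket n h (Const c) = 0"
  by (simp_all add: poisson_bracket_def partial_Const)

lemma poisson_bracket_numeral: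
  "poisson_bracket n (numeral k) h = 0" "poisson_bracket n h (numeral k) = 0"
  "poisson_bracket n 1 h = 0" "poisson_bracket n h 1 = 0"
  "poisson_bracket n 0 h = 0" "poisson_bracket n h 0 = 0"
  by (simp_all add: poisson_bracket_Const flip: Const_hom)

lemma poisson_bracket_antisym: "poisson_bracket n f g = - poisson_bracket n g f"
  by (simp add: poisson_bracket_def sum_negf [symmetric] algebra_simps)

lemma poisson_bracket_flip: "poisson_bracket n f g = h \<Longrightarrow> poisson_bracket n g f = - h"
  by (metis poisson_bracket_antisym)

lemma poisson_bracket_minus:
  "poisson_bracket n (- f) h = - poisson_bracket n f h"
  "poisson_bracket n h (- f) = - poisson_bracket n h f"
  using poisson_bracket_add(1)[of n f "- f" h] poisson_bracket_add(2)[of n h f "- f"]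
    poisson_bracket_numeral(5,6)[of n h]
  by (simp_all add: eq_neg_iff_add_eq_0 add.commute)

lemma poisson_bracket_diff:
  "poisson_bracket n (f - g) h = poisson_bracket n f h - poisson_bracket n g h"
  "poisson_bracket n h (f - g) = poisson_bracket n h f - poisson_bracket n h g"
  using poisson_bracket_add(1)[of n f "- g" h] poisson_bracket_add(2)[of n h f "- g"]
  by (simp_all add: poisson_bracket_minus)

lemma poisson_bracket_power:
  "poisson_bracket n (f ^ k) h = of_nat k * f ^ (k - 1) * poisson_bracket n f h"
proof (induction k)
  case (Suc k)
  then show ?case
    by (cases k) (simp_all add: poisson_bracket_mult poisson_bracket_numeral algebra_simps)
qed (simp add: poisson_bracket_numeral)

lemma poisson_bracket_power_right:
  "poisson_bracket n h (f ^ k) = of_nat k * f ^ (k - 1) * poisson_bracket n h f"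
  by (simp add: poisson_bracket_antisym[of n h] poisson_bracket_power)

subsection \<open>Substitution\<close>

definition monomial_subst :: "(pvar \<Rightarrow> cpoly) \<Rightarrow> (pvar \<Rightarrow>\<^sub>0 nat) \<Rightarrow> cpoly" where
  "monomial_subst \<phi> m = (\<Prod>v\<in>Poly_Mapping.keys m. \<phi> v ^ Poly_Mapping.lookup m v)"

definition subst :: "(pvar \<Rightarrow> cpoly) \<Rightarrow> cpoly \<Rightarrow> cpoly" where
  "subst \<phi> f = (\<Sum>m\<in>Poly_Mapping.keys f. Const (Poly_Mapping.lookup f m) * monomial_subst \<phi> m)"

text \<open>Variables of exponent 0 only add factors 1, so two monomials can be expanded over a
  common index set.\<close>

lemma monomial_subst_superset:
  "finite A \<Longrightarrow> Poly_Mapping.keys m \<subseteq> A \<Longrightarrow>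
     monomial_subst \<phi> m = (\<Prod>v\<in>A. \<phi> v ^ Poly_Mapping.lookup m v)"
  unfolding monomial_subst_def
  by (rule prod.mono_neutral_left) (auto simp: in_keys_iff)

lemma monomial_subst_add: "monomial_subst \<phi> (m + k) = monomial_subst \<phi> m * monomial_subst \<phi> k"
proof -
  let ?A = "Poly_Mapping.keys m \<union> Poly_Mapping.keys k"
  have "Poly_Mapping.keys (m + k) \<subseteq> ?A" by (rule keys_add)
  then show ?thesis
    by (simp add: monomial_subst_superset[of ?A] lookup_add power_add prod.distrib)
qed

lemma subst_zero [simp]: "subst \<phi> 0 = 0"
  by (simp add: subst_def)

lemma subst_single: "subst \<phi> (Poly_Mapping.single m c) = Const c * monomial_subst \<phi> m"
  by (simp add: subst_def Const_hom)

lemma subst_add: "subst \<phi> (f + g) = subst \<phi> f + subst \<phi> g"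
  unfolding subst_def by (rule sum_keys_add) (auto simp: Const_hom distrib_right)

lemma subst_mult: "subst \<phi> (f * g) = subst \<phi> f * subst \<phi> g"
proof (induction f rule: poly_mapping_additive_induct)
  case (single m c)
  show ?case
    by (induction g rule: poly_mapping_additive_induct)
       (simp_all add: mult_single subst_single subst_add distrib_left distrib_right monomial_subst_add Const_hom mult_ac)
qed (simp_all add: subst_add distrib_right)

lemma subst_Const: "subst \<phi> (Const c) = Const c"
  by (simp add: Const_def[of c] subst_single) (simp add: monomial_subst_def Const_def)

lemma subst_Var: "subst \<phi> (Var v) = \<phi> v"
  by (simp add: Var_def subst_single Const_hom monomial_subst_def)

lemma subst_numeral: "subst \<phi> 1 = 1" "subst \<phi> (numeral k) = numeral k"
  using subst_Const[of \<phi> 1] subst_Const[of \<phi> "numeral k"] by (simp_all add: Const_hom)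

lemma subst_minus: "subst \<phi> (- f) = - subst \<phi> f"
  using subst_add[of \<phi> "- f" f] by (simp add: eq_neg_iff_add_eq_0)

lemma subst_diff: "subst \<phi> (f - g) = subst \<phi> f - subst \<phi> g"
  using subst_add[of \<phi> f "- g"] by (simp add: subst_minus)

lemma subst_power: "subst \<phi> (f ^ k) = subst \<phi> f ^ k"
  by (induction k) (simp_all add: subst_mult subst_numeral)

subsection \<open>The polynomial algebra in finitely many variables\<close>

lemma carrier_Const: "Const c \<in> poisson_carrier n"
  by (simp add: poisson_carrier_def Const_def)

lemma carrier_Var: "v \<in> Xvar ` {1..n} \<union> Pvar ` {1..n} \<Longrightarrow> Var v \<in> poisson_carrier n"
  by (simp add: poisson_carrier_def Var_def)

lemma carrier_add:
  "f \<in> poisson_carrier n \<Longrightarrow> g \<in> poisson_carrier n \<Longrightarrow> f + g \<in> poisson_carrier n"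
  unfolding poisson_carrier_def using keys_add[of f g] by blast

lemma carrier_mult:
  assumes "f \<in> poisson_carrier n" "g \<in> poisson_carrier n"
  shows "f * g \<in> poisson_carrier n"
  unfolding poisson_carrier_def
proof (intro CollectI ballI)
  fix m assume "m \<in> Poly_Mapping.keys (f * g)"
  then obtain a b where "a \<in> Poly_Mapping.keys f" "b \<in> Poly_Mapping.keys g" "m = a + b"
    using keys_mult[of f g] by auto
  with assms have "Poly_Mapping.keys a \<union> Poly_Mapping.keys b \<subseteq> Xvar ` {1..n} \<union> Pvar ` {1..n}"
    by (simp add: poisson_carrier_def)
  with keys_add[of a b] \<open>m = a + b\<close>
  show "Poly_Mapping.keys m \<subseteq> Xvar ` {1..n} \<union> Pvar ` {1..n}"
    by (metis order_trans)
qed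

lemma carrier_numeral:
  "0 \<in> poisson_carrier n" "1 \<in> poisson_carrier n" "numeral k \<in> poisson_carrier n"
  using carrier_Const[of 0 n] carrier_Const[of 1 n] carrier_Const[of "numeral k" n]
  by (simp_all add: Const_hom)

lemma carrier_minus: "f \<in> poisson_carrier n \<Longrightarrow> - f \<in> poisson_carrier n"
  by (simp add: poisson_carrier_def)

lemma carrier_diff:
  "f \<in> poisson_carrier n \<Longrightarrow> g \<in> poisson_carrier n \<Longrightarrow> f - g \<in> poisson_carrier n"
  using carrier_add[of f n "- g"] by (simp add: carrier_minus)

lemma carrier_power: "f \<in> poisson_carrier n \<Longrightarrow> f ^ k \<in> poisson_carrier n"
  by (induction k) (simp_all add: carrier_mult carrier_numeral)

text \<open>Each monomial is a product of variables of the carrier, so constants and variables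
  generate it as a ring. Identities between homomorphisms or derivations then need checking on
  generators only.\<close>

lemma carrier_induct [consumes 1, case_names Const Var add mult]:
  assumes "f \<in> poisson_carrier n"
    and Const: "\<And>c. P (Const c)"
    and Var: "\<And>v. v \<in> Xvar ` {1..n} \<union> Pvar ` {1..n} \<Longrightarrow> P (Var v)"
    and add: "\<And>f g. P f \<Longrightarrow> P g \<Longrightarrow> P (f + g)"
    and mult: "\<And>f g. P f \<Longrightarrow> P g \<Longrightarrow> P (f * g)"
  shows "P f"
proof -
  let ?V = "Xvar ` {1..n} \<union> Pvar ` {1..n}"
  have pow: "P (Var v ^ k)" if "v \<in> ?V" for v k
    using Const[of 1] Var[OF that] by (induction k) (simp_all add: Const_hom mult)
  have prod: "P (\<Prod>v\<in>A. Var v ^ e v)" if "finite A" "A \<subseteq> ?V" for A e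
    using that Const[of 1] by (induction A) (simp_all add: Const_hom mult pow)
  have sum: "P (\<Sum>m\<in>M. Const (Poly_Mapping.lookup f m) * monomial_subst Var m)"
    if "finite M" "\<And>m. m \<in> M \<Longrightarrow> Poly_Mapping.keys m \<subseteq> ?V" for M
    using that
  proof (induction M)
    case empty
    then show ?case using Const[of 0] by (simp add: Const_hom)
  next
    case (insert m M)
    then have "P (monomial_subst Var m)"
      unfolding monomial_subst_def by (intro prod) auto
    with insert show ?case by (simp add: add mult Const)
  qed
  \<comment> \<open>Unfolded, this identity writes a polynomial as a sum of constants times products
    of powers of variables, the form that \<open>sum\<close> handles.\<close>
  have "subst Var g = g" for g
  proof (induction g rule: poly_mapping_additive_induct)
    case (single m c)
    have "monomial_subst Var m = Poly_Mapping.single m 1"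
    proof (induction m rule: poly_mapping_additive_induct)
      case (single v k)
      have "Var v ^ k = Poly_Mapping.single (Poly_Mapping.single v k) 1"
        by (induction k) (simp_all add: Var_def mult_single flip: single_add)
      then show ?case by (cases "k = 0") (auto simp: monomial_subst_def)
    qed (auto simp: monomial_subst_add mult_single, simp add: monomial_subst_def)
    then show ?case by (simp add: subst_single Const_def mult_single)
  qed (simp_all add: subst_add)
  then have "f = (\<Sum>m\<in>Poly_Mapping.keys f. Const (Poly_Mapping.lookup f m) * monomial_subst Var m)"
    by (metis subst_def)
  moreover have "P \<dots>"
    using assms(1) by (intro sum) (auto simp: poisson_carrier_def)
  ultimately show ?thesis by simp
qed

lemma subst_carrier:
  assumes "f \<in> poisson_carrier n"
    and "\<And>v. v \<in> Xvar ` {1..n} \<union> Pvar ` {1..n} \<Longrightarrow> \<phi> v \<in> poisson_carrier n"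
  shows "subst \<phi> f \<in> poisson_carrier n"
  using assms(1)
  by (induction rule: carrier_induct)
     (simp_all add: subst_Const subst_Var subst_add subst_mult carrier_Const carrier_add carrier_mult assms(2))

text \<open>In each argument both sides are derivations along \<open>subst \<phi>\<close>; induction
  on \<open>f\<close> and then on \<open>g\<close> leaves only pairs of variables.\<close>

lemma subst_poisson_bracket:
  assumes "f \<in> poisson_carrier n" "g \<in> poisson_carrier n"
    and gens: "\<And>v w. v \<in> Xvar ` {1..n} \<union> Pvar ` {1..n} \<Longrightarrow> w \<in> Xvar ` {1..n} \<union> Pvar ` {1..n} \<Longrightarrow>
      subst \<phi> (poisson_bracket n (Var v) (Var w)) = poisson_bracket n (\<phi> v) (\<phi> w)"
  shows "subst \<phi> (poisson_bracket n f g) = poisson_bracket n (subst \<phi> f) (subst \<phi> g)"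
  using assms(1)
proof (induction rule: carrier_induct)
  case (Var v)
  note v = Var
  show ?case
    using assms(2)
  proof (induction rule: carrier_induct)
    case (Var w)
    show ?case using gens[OF v Var] by (simp only: subst_Var)
  qed (simp_all add: poisson_bracket_Const poisson_bracket_add poisson_bracket_mult
         subst_Const subst_add subst_mult)
qed (simp_all add: poisson_bracket_Const poisson_bracket_add poisson_bracket_mult
       subst_Const subst_add subst_mult)

subsection \<open>The counterexample in dimension two\<close>

definition orbit_r :: "'a \<Rightarrow> 'a \<Rightarrow> 'a \<Rightarrow> 'a \<Rightarrow> 'a::comm_ring_1" where
  "orbit_r x s t q = 6 * t * (1 - x * s) - 3 * x^2 * q"

definition orbit_y :: "'a \<Rightarrow> 'a \<Rightarrow> 'a \<Rightarrow> 'a \<Rightarrow> 'a::comm_ring_1" where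
  "orbit_y x s t q = s + x^2 * s^3 + x * orbit_r x s t q"

text \<open>The summands \<open>- 27 * r - 27 * x * s^3\<close> are \<open>27 z\<close> with
  \<open>z = - x s^3 - r\<close>.\<close>

definition F1 :: "'a \<Rightarrow> 'a \<Rightarrow> 'a \<Rightarrow> 'a \<Rightarrow> 'a::comm_ring_1" where
  "F1 x s t q = (let r = orbit_r x s t q; y = orbit_y x s t q in
     27 * y * s - 27 * r - 27 * x * s^3 + 9 * x * y^2 * s + x^2 * y^3 * s - 15 * y^2 - 2 * x * y^3)"

definition F2 :: "'a \<Rightarrow> 'a \<Rightarrow> 'a \<Rightarrow> 'a \<Rightarrow> 'a::comm_ring_1" where
  "F2 x s t q = (let y = orbit_y x s t q in s * (3 + x * y)^2 - 8 * y - 2 * x * y^2)"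

definition F3 :: "'a \<Rightarrow> 'a \<Rightarrow> 'a::comm_ring_1" where
  "F3 x s = 2 * x - x^2 * s"

text \<open>Homogeneous of weight 4 when \<open>x, s, t, q\<close> have weights -1, 1, 2, 4. Then
  \<open>v\<close> has weight 0 and \<open>r\<close> weight 2, which explains the grouping by powers
  of \<open>r\<close> with coefficients in \<open>v\<close>.\<close>

definition partner :: "'a \<Rightarrow> 'a \<Rightarrow> 'a \<Rightarrow> 'a \<Rightarrow> 'a::comm_ring_1" where
  "partner x s t q = (let r = orbit_r x s t q; v = x * s in
     (145 - 296 * v + 218 * v^2 + 170 * v^3 - 220 * v^4 + 130 * v^5 + 20 * v^6 - 80 * v^7
       + 35 * v^8 - 10 * v^9 - 10 * v^10 + 4 * v^11 - 2 * v^12) * s^4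
   + (- 3240 + 6180 * v - 1920 * v^2 - 5220 * v^3 + 5760 * v^4 - 2700 * v^5 - 1920 * v^6
       + 2400 * v^7 - 1200 * v^8 + 360 * v^10 - 180 * v^11 + 60 * v^12) * s^2 * t
   + (- 810 - 810 * v + 810 * v^2 - 2280 * v^3 - 1320 * v^4 + 1290 * v^5 - 1590 * v^6 - 240 * v^7
       + 720 * v^8 - 480 * v^9 + 120 * v^10 + 120 * v^11 - 60 * v^12 + 30 * v^13) * q
   + (540 + 270 * v - 210 * v^2 + 670 * v^3 + 100 * v^4 - 240 * v^5 + 270 * v^6 - 60 * v^7
       - 60 * v^8 + 40 * v^9 - 20 * v^10) * r^2
   + (270 + 40 * v - 80 * v^2 + 200 * v^3 - 40 * v^4 - 40 * v^5 + 40 * v^6 - 20 * v^7) * x^2 * r^3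
   + (55 - 10 * v - 10 * v^2 + 20 * v^3 - 10 * v^4) * x^4 * r^4
   + (4 - 2 * v) * x^6 * r^5)"

definition partner_num :: "'a \<Rightarrow> 'a \<Rightarrow> 'a \<Rightarrow> 'a \<Rightarrow> 'a::comm_ring_1" where
  "partner_num x s t q = (let y = orbit_y x s t q; v = x * s; u = x * y in
     - (1620 * x^2 * t) - 270 * v + 270 * v^2 + 270 * u - 810 * u * v + 540 * u^2 - 540 * u^2 * v
     + 270 * u^3 - 180 * u^3 * v + 55 * u^4 - 30 * u^4 * v + 4 * u^5 - 2 * u^5 * v)"

text \<open>
  Times \<open>x^4\<close>, the conjugate of \<open>F3\<close> is a polynomial in \<open>x, s, y, t\<close> of low degree, whose brackets
  are easy to compute; the term \<open>x^2 s^3\<close> in \<open>y\<close> is what makes it divisible by \<open>x^4\<close>.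
\<close>

lemma partner_times_x4: "x^4 * partner x s t q = partner_num x s t q" for x s t q :: "'a::idom"
  unfolding partner_def partner_num_def orbit_y_def orbit_r_def Let_def by algebra

lemmas poisson_bracket_simps =
  poisson_bracket_add poisson_bracket_diff poisson_bracket_minus poisson_bracket_mult
  poisson_bracket_power poisson_bracket_power_right poisson_bracket_numeral

lemma poisson_bracket_Var:
  "i \<in> {1..n} \<Longrightarrow> poisson_bracket n (Var (Pvar i)) (Var (Xvar j)) = (if i = j then 1 else 0)"
  "i \<in> {1..n} \<Longrightarrow> poisson_bracket n (Var (Xvar j)) (Var (Pvar i)) = (if i = j then - 1 else 0)"
  "poisson_bracket n (Var (Pvar i)) (Var (Pvar j)) = 0"
  "poisson_bracket n (Var (Xvar i)) (Var (Xvar j)) = 0"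
  using poisson_bracket_antisym[of n "Var (Xvar j)" "Var (Pvar i)"]
  by (simp_all add: poisson_bracket_Pvar_Xvar)
     (simp_all add: poisson_bracket_def partial_Var)

section \<open>Brackets of the four components in Darboux coordinates\<close>

context
  fixes n :: nat and x s t q :: cpoly
  assumes x0: "x \<noteq> 0"
    and br: "poisson_bracket n x s = 0" "poisson_bracket n x t = 0" "poisson_bracket n x q = 1"
      "poisson_bracket n t s = 1" "poisson_bracket n s q = 0" "poisson_bracket n t q = 0"
begin

abbreviation (input) "pb \<equiv> poisson_bracket n"
abbreviation (input) "r \<equiv> orbit_r x s t q"
abbreviation (input) "y \<equiv> orbit_y x s t q"

lemma br_flip:
  "pb s x = 0" "pb t x = 0" "pb q x = - 1" "pb s t = - 1" "pb q s = 0" "pb q t = 0"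
  "pb f f = 0"
  using br poisson_bracket_antisym[of n s x] poisson_bracket_antisym[of n t x]
    poisson_bracket_antisym[of n q x] poisson_bracket_antisym[of n s t]
    poisson_bracket_antisym[of n q s] poisson_bracket_antisym[of n q t]
  by (simp_all add: poisson_bracket_def mult.commute)

text \<open>These brackets and those of \<open>y\<close> let \<open>r\<close> be treated as an atom:
  the computations below become polynomial identities in \<open>x, s, t, r\<close> once
  \<open>y\<close> is expanded.\<close>

lemma br_r:
  "pb x r = - (3 * x^2)" "pb s r = - (6 * (1 - x * s))" "pb t r = - (6 * x * t)"
  unfolding orbit_r_def
  by (simp_all add: poisson_bracket_simps br br_flip)

lemma br_r_flip: "pb r x = 3 * x^2" "pb r s = 6 * (1 - x * s)" "pb r t = 6 * x * t"
  using br_r poisson_bracket_antisym[of n r] by simp_all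

lemma br_y:
  "pb x y = - (3 * x^3)" "pb s y = - (6 * x * (1 - x * s))"
  "pb t y = 1 + 3 * x^2 * s^2 - 6 * x^2 * t"
  "pb r y = 6 * (1 - x * s) * (1 + 3 * x^2 * s^2) + 6 * x^3 * s^3 + 3 * x^2 * r"
  unfolding orbit_y_def
  by (simp_all add: poisson_bracket_simps br br_flip br_r br_r_flip power2_eq_square power3_eq_cube algebra_simps)

lemma br_y_flip:
  "pb y x = 3 * x^3" "pb y s = 6 * x * (1 - x * s)"
  "pb y t = - (1 + 3 * x^2 * s^2 - 6 * x^2 * t)"
  "pb y r = - (6 * (1 - x * s) * (1 + 3 * x^2 * s^2) + 6 * x^3 * s^3 + 3 * x^2 * r)"
  using br_y poisson_bracket_antisym[of n y] by simp_all

lemmas br_all = br br_flip br_r br_r_flip br_y br_y_flip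

lemma br_F2_F1: "pb (F2 x s t q) (F1 x s t q) = 162"
proof -
  show ?thesis
    unfolding F1_def F2_def Let_def
    apply (simp add: poisson_bracket_simps br_all)
    apply (rule mult_left_cancel [OF x0, THEN iffD1])
    unfolding orbit_y_def by algebra
qed

text \<open>\<open>F3\<close> commutes with \<open>x\<close> and \<open>s\<close>, and also with
  \<open>r\<close> because \<open>{r, x} * (2 - 2 * x * s) = {r, s} * x^2\<close>. Hence it commutes
  with \<open>y\<close> and with every polynomial in \<open>x, s, r, y\<close>.\<close>

lemma br_F1_F3: "pb (F1 x s t q) (F3 x s) = 0"
  unfolding F1_def F3_def Let_def
  apply (simp add: poisson_bracket_simps br_all)
  unfolding orbit_y_def by algebra

lemma br_F2_F3: "pb (F2 x s t q) (F3 x s) = 0"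
  unfolding F2_def F3_def Let_def
  apply (simp add: poisson_bracket_simps br_all)
  unfolding orbit_y_def by algebra

text \<open>The Leibniz rule for \<open>x^4 * partner\<close>. It transfers brackets from
  \<open>partner_num\<close> to \<open>partner\<close>, after which \<open>x^4\<close> is
  cancelled.\<close>

lemma br_partner_num: "pb (partner_num x s t q) f = x^4 * pb (partner x s t q) f + 4 * x^3 * partner x s t q * pb x f"
  by (simp add: poisson_bracket_simps flip: partner_times_x4)

lemma br_x_F3:
  "4 * x^3 * partner x s t q * pb x (F3 x s) = 0"
  by (simp add: F3_def poisson_bracket_simps br_all)

text \<open>As \<open>x, s, y\<close> commute with \<open>F3\<close>, only the term
  \<open>- (1620 * x^2 * t)\<close> of \<open>partner_num\<close> contributes, and
  \<open>{t, F3} = - x^2\<close>.\<close>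

lemma br_partner_F3: "pb (partner x s t q) (F3 x s) = 1620"
proof -
  have "pb (partner_num x s t q) (F3 x s) = x^4 * 1620"
    unfolding partner_num_def F3_def Let_def
    apply (simp add: poisson_bracket_simps br_all)
    unfolding orbit_y_def by algebra
  with br_partner_num[of "F3 x s"] br_x_F3 have "x^4 * pb (partner x s t q) (F3 x s) = x^4 * 1620" by simp
  with x0 show ?thesis by (subst (asm) mult_cancel_left) simp
qed

lemma br_partner_F2: "pb (partner x s t q) (F2 x s t q) = 0"
proof -
  \<comment> \<open>This is \<open>4 * {x, F2} / x\<close>, where \<open>{x, F2}\<close> is
    \<open>- 3 * x^3\<close> times the derivative of \<open>F2\<close> in \<open>y\<close>. If
    \<open>{partner_num, F2}\<close> equals \<open>partner_num * c\<close>, it is accounted for by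
    the factor \<open>x^4\<close> alone.\<close>
  define c where "c = - 12 * x^2 * (2 * s * x * (3 + x * y) - 8 - 4 * x * y)"
  have "4 * x^3 * pb x (F2 x s t q) = x^4 * c"
    unfolding F2_def Let_def c_def
    apply (simp add: poisson_bracket_simps br_all)
    by algebra
  then have "4 * x^3 * partner x s t q * pb x (F2 x s t q) = partner_num x s t q * c"
    unfolding partner_times_x4 [symmetric] by algebra
  moreover have "pb (partner_num x s t q) (F2 x s t q) = partner_num x s t q * c"
    unfolding partner_num_def F2_def Let_def c_def
    apply (simp add: poisson_bracket_simps br_all)
    unfolding orbit_y_def by algebra
  ultimately have "x^4 * pb (partner x s t q) (F2 x s t q) = 0"
    using br_partner_num[of "F2 x s t q"] by simp
  with x0 show ?thesis by simp
qed

lemma br_partner_F1: "pb (partner x s t q) (F1 x s t q) = 0"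
proof -
  \<comment> \<open>Again \<open>4 * {x, F1} / x\<close>; the summand 81 comes from
    \<open>- 27 * r\<close> in \<open>F1\<close>, the others from the derivative in
    \<open>y\<close>.\<close>
  define c where "c = 4 * x * (81 - 3 * x * (27 * s + 18 * x * y * s + 3 * x^2 * y^2 * s - 30 * y - 6 * x * y^2))"
  have "4 * x^3 * pb x (F1 x s t q) = x^4 * c"
    unfolding F1_def Let_def c_def
    apply (simp add: poisson_bracket_simps br_all)
    by algebra
  then have "4 * x^3 * partner x s t q * pb x (F1 x s t q) = partner_num x s t q * c"
    unfolding partner_times_x4 [symmetric] by algebra
  moreover have "pb (partner_num x s t q) (F1 x s t q) = partner_num x s t q * c"
    unfolding partner_num_def F1_def Let_def c_def
    apply (simp add: poisson_bracket_simps br_all)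
    unfolding orbit_y_def by algebra
  ultimately have "x^4 * pb (partner x s t q) (F1 x s t q) = 0"
    using br_partner_num[of "F1 x s t q"] by simp
  with x0 show ?thesis by simp
qed

end

section \<open>The endomorphism for n \<ge> 2\<close>

definition vars2 :: "pvar set" where
  "vars2 = {Xvar 1, Pvar 1, Xvar 2, Pvar 2}"

text \<open>The momenta are \<open>x\<close> and \<open>t\<close>, matching
  \<open>{x, q} = {t, s} = 1\<close>. The factors 1/1620 and 1/162 normalise the brackets of the two
  conjugate pairs, and fixing all further variables extends the map to higher dimension.\<close>

definition endo_var :: "pvar \<Rightarrow> cpoly" where
  "endo_var v =
    (let x = Var (Pvar 1); q = Var (Xvar 1); t = Var (Pvar 2); s = Var (Xvar 2) in
     if v = Xvar 1 then F3 x s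
     else if v = Pvar 1 then Const (1 / 1620) * partner x s t q
     else if v = Xvar 2 then F1 x s t q
     else if v = Pvar 2 then Const (1 / 162) * F2 x s t q
     else Var v)"

lemma poisson_bracket_Const_mult:
  "poisson_bracket n (Const c * f) g = Const c * poisson_bracket n f g"
  "poisson_bracket n g (Const c * f) = Const c * poisson_bracket n g f"
  by (simp_all add: poisson_bracket_mult poisson_bracket_Const)

lemma Const_inverse_mult: "Const (1 / numeral k) * numeral k = 1"
  by (simp flip: Const_hom)

lemma Var_neq_0: "Var v \<noteq> 0"
  using partial_Var[of v v] by (metis partial_zero zero_neq_one)

lemma endo_var_bracket_vars2:
  assumes "n \<ge> 2" "v \<in> vars2" "w \<in> vars2"
  shows "poisson_bracket n (endo_var v) (endo_var w) = poisson_bracket n (Var v) (Var w)"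
proof -
  let ?x = "Var (Pvar 1)" and ?q = "Var (Xvar 1)" and ?t = "Var (Pvar 2)" and ?s = "Var (Xvar 2)"
  have br: "poisson_bracket n ?x ?s = 0" "poisson_bracket n ?x ?t = 0" "poisson_bracket n ?x ?q = 1"
    "poisson_bracket n ?t ?s = 1" "poisson_bracket n ?s ?q = 0" "poisson_bracket n ?t ?q = 0"
    using assms(1) by (simp_all add: poisson_bracket_Var)
  note F = br_F2_F1[OF Var_neq_0 br] br_F1_F3[OF Var_neq_0 br] br_F2_F3[OF Var_neq_0 br]
    br_partner_F1[OF Var_neq_0 br] br_partner_F2[OF Var_neq_0 br] br_partner_F3[OF Var_neq_0 br]
  note F' = F[THEN poisson_bracket_flip]
  have self: "poisson_bracket n f f = 0" for f
    by (simp add: poisson_bracket_def mult.commute)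
  show ?thesis
    using assms(2,3) unfolding vars2_def
    by (elim insertE emptyE)
       (simp_all add: endo_var_def Let_def F F' self br br[THEN poisson_bracket_flip]
         poisson_bracket_Const_mult Const_inverse_mult del: One_nat_def)
qed

text \<open>A variable fails to commute only with its conjugate, which has the same index; the
  derivation property passes this on to polynomials.\<close>

lemma poisson_bracket_carrier_far:
  assumes "f \<in> poisson_carrier k" "i > k"
  shows "poisson_bracket n f (Var (Xvar i)) = 0" "poisson_bracket n f (Var (Pvar i)) = 0"
proof -
  have "poisson_bracket n f (Var (Xvar i)) = 0 \<and> poisson_bracket n f (Var (Pvar i)) = 0"
    using assms(1)
  proof (induction rule: carrier_induct)
    case (Var v)
    have "poisson_bracket n (Var (Pvar j)) (Var (Xvar i)) = 0"
      "poisson_bracket n (Var (Xvar j)) (Var (Pvar i)) = 0" if "j \<noteq> i" for j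
      using that by (auto simp: poisson_bracket_def partial_Var intro!: sum.neutral)
    with Var assms(2) show ?case by (auto simp: poisson_bracket_Var)
  qed (simp_all add: poisson_bracket_Const poisson_bracket_add poisson_bracket_mult)
  then show "poisson_bracket n f (Var (Xvar i)) = 0" "poisson_bracket n f (Var (Pvar i)) = 0"
    by simp_all
qed

lemma carrier_mono: "k \<le> n \<Longrightarrow> poisson_carrier k \<subseteq> poisson_carrier n"
  by (force simp: poisson_carrier_def)

lemma endo_var_vars2_carrier:
  assumes "v \<in> vars2"
  shows "endo_var v \<in> poisson_carrier 2"
proof -
  have "Var w \<in> poisson_carrier 2" if "w \<in> vars2" for w
    using that by (intro carrier_Var) (auto simp: vars2_def)
  then have "Var (Xvar 1) \<in> poisson_carrier 2" "Var (Pvar 1) \<in> poisson_carrier 2"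
    "Var (Xvar 2) \<in> poisson_carrier 2" "Var (Pvar 2) \<in> poisson_carrier 2"
    by (simp_all add: vars2_def)
  then show ?thesis
    using assms
    by (auto simp: vars2_def endo_var_def F1_def F2_def F3_def partner_def orbit_y_def orbit_r_def Let_def
        intro!: carrier_mult carrier_add carrier_diff carrier_minus carrier_power carrier_numeral carrier_Const)
qed

lemma endo_var_far: "v \<notin> vars2 \<Longrightarrow> endo_var v = Var v"
  by (simp add: vars2_def endo_var_def)

lemma endo_var_bracket:
  assumes "n \<ge> 2" "v \<in> Xvar ` {1..n} \<union> Pvar ` {1..n}" "w \<in> Xvar ` {1..n} \<union> Pvar ` {1..n}"
  shows "poisson_bracket n (endo_var v) (endo_var w) = poisson_bracket n (Var v) (Var w)"
proof -
  have far: "\<exists>i>2. u = Xvar i \<or> u = Pvar i" if "u \<in> Xvar ` {1..n} \<union> Pvar ` {1..n}" "u \<notin> vars2" for u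
  proof -
    from that(1) obtain i where i: "i \<ge> 1" "u = Xvar i \<or> u = Pvar i" by auto
    with that(2) have "i \<noteq> 1" "i \<noteq> 2" by (auto simp: vars2_def)
    with i show ?thesis by (intro exI[of _ i]) auto
  qed
  have vars2_far: "poisson_bracket n (endo_var u) (endo_var u') = poisson_bracket n (Var u) (Var u')"
    if "u \<in> vars2" "u' \<notin> vars2" "u' \<in> Xvar ` {1..n} \<union> Pvar ` {1..n}" for u u'
  proof -
    from far[OF that(3,2)] obtain i where i: "i > 2" "u' = Xvar i \<or> u' = Pvar i" by auto
    have "Var u \<in> poisson_carrier 2"
      using that(1) by (intro carrier_Var) (auto simp: vars2_def)
    then show ?thesis
      using i endo_var_vars2_carrier[OF that(1)] that(2)
      by (auto simp: poisson_bracket_carrier_far endo_var_far)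
  qed
  consider "v \<in> vars2" "w \<in> vars2" | "v \<in> vars2" "w \<notin> vars2" | "v \<notin> vars2" "w \<in> vars2" | "v \<notin> vars2" "w \<notin> vars2"
    by blast
  then show ?thesis
  proof cases
    case 1
    then show ?thesis by (rule endo_var_bracket_vars2[OF assms(1)])
  next
    case 2
    then show ?thesis by (rule vars2_far[OF _ _ assms(3)])
  next
    case 3
    then show ?thesis
      using vars2_far[OF 3(2,1) assms(2)]
        poisson_bracket_antisym[of n "endo_var v"] poisson_bracket_antisym[of n "Var v"] by simp
  next
    case 4
    then show ?thesis by (simp add: endo_var_far)
  qed
qed

text \<open>Brackets of variables are 0, 1 or -1, hence unchanged by any substitution. Compatibility
  on generators thus means that the images have the same brackets as the variables.\<close>

lemma subst_bracket_Var:
  assumes "v \<in> Xvar ` {1..n} \<union> Pvar ` {1..n}" "w \<in> Xvar ` {1..n} \<union> Pvar ` {1..n}"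
  shows "subst \<phi> (poisson_bracket n (Var v) (Var w)) = poisson_bracket n (Var v) (Var w)"
  using assms by (auto simp: poisson_bracket_Var subst_numeral subst_minus)

lemma endo_poisson_endomorphism:
  assumes "n \<ge> 2"
  shows "poisson_endomorphism n (subst endo_var)"
proof -
  have "endo_var v \<in> poisson_carrier n" if "v \<in> Xvar ` {1..n} \<union> Pvar ` {1..n}" for v
    using endo_var_vars2_carrier[of v] carrier_mono[OF assms] carrier_Var[OF that] endo_var_far[of v]
    by (cases "v \<in> vars2") auto
  then have "\<forall>f\<in>poisson_carrier n. subst endo_var f \<in> poisson_carrier n"
    by (intro ballI subst_carrier)
  moreover have "subst endo_var (poisson_bracket n f g) =
      poisson_bracket n (subst endo_var f) (subst endo_var g)"
    if "f \<in> poisson_carrier n" "g \<in> poisson_carrier n" for f g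
    using that
    by (rule subst_poisson_bracket) (simp only: subst_bracket_Var endo_var_bracket[OF assms])
  ultimately show ?thesis
    by (simp add: poisson_endomorphism_def algebra_endomorphism_def subst_Const subst_add subst_mult)
qed

section \<open>Two points with the same image\<close>

definition collision_point :: "complex \<Rightarrow> pvar \<Rightarrow> cpoly" where
  "collision_point \<epsilon> v = (if v = Pvar 1 then Const \<epsilon> else if v = Xvar 2 then 2 * Const \<epsilon>
     else if v = Xvar 1 then Const (29 / 6) else 0)"

lemmas subst_simps = subst_add subst_diff subst_minus subst_mult subst_power subst_numeral subst_Const subst_Var

lemma subst_F:
  "subst \<phi> (F1 x s t q) = F1 (subst \<phi> x) (subst \<phi> s) (subst \<phi> t) (subst \<phi> q)"
  "subst \<phi> (F2 x s t q) = F2 (subst \<phi> x) (subst \<phi> s) (subst \<phi> t) (subst \<phi> q)"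
  "subst \<phi> (F3 x s) = F3 (subst \<phi> x) (subst \<phi> s)"
  "subst \<phi> (partner x s t q) = partner (subst \<phi> x) (subst \<phi> s) (subst \<phi> t) (subst \<phi> q)"
  by (simp_all add: F1_def F2_def F3_def partner_def orbit_y_def orbit_r_def Let_def subst_simps)

text \<open>At \<open>x = 1, s = 2\<close> the component \<open>F3\<close> vanishes, and with
  \<open>t = 0\<close> the condition \<open>6 * c = 29\<close> says that
  \<open>F2 = 58 - 12 * c\<close> vanishes as well. \<open>F1\<close> and \<open>partner\<close>
  agree at the mirror point by symmetry.\<close>

lemma F_collision:
  fixes c :: cpoly
  assumes "6 * c = 29"
  shows "F1 1 2 0 c = F1 (- 1) (- 2) 0 c" "F2 1 2 0 c = F2 (- 1) (- 2) 0 c"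
    "F3 (1 :: cpoly) 2 = F3 (- 1) (- 2)" "partner 1 2 0 c = partner (- 1) (- 2) 0 c"
proof -
  have "F2 1 2 0 c = 58 - 2 * (6 * c)" "F2 (- 1) (- 2) 0 c = - 58 + 2 * (6 * c)"
    by (simp_all add: F2_def orbit_y_def orbit_r_def Let_def power2_eq_square algebra_simps)
  then show "F2 1 2 0 c = F2 (- 1) (- 2) 0 c"
    by (simp add: assms)
\<comment> \<open>The values of \<open>orbit_y\<close> at the two points are
  \<open>10 - 3 * c\<close> and \<open>3 * c - 10\<close>; \<open>power2_commute\<close> identifies
  their squares.\<close>
qed (simp_all add: F1_def F3_def partner_def orbit_y_def orbit_r_def Let_def power2_commute [of 10])

lemma Const_minus_1: "Const (- 1) = - 1"
  using Const_hom(4)[of "- 1" 1] by (simp add: Const_hom eq_neg_iff_add_eq_0)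

lemma endo_var_collision: "subst (collision_point 1) (endo_var v) = subst (collision_point (- 1)) (endo_var v)"
proof -
  have c: "6 * Const (29 / 6) = 29"
    by (simp flip: Const_hom)
  show ?thesis
    by (simp add: endo_var_def Let_def subst_F subst_simps collision_point_def Const_hom Const_minus_1 F_collision[OF c])
qed

theorem corollary8p1:
  fixes n :: nat
  assumes "n \<ge> 2"
  shows "\<not> PC n"
proof
  assume "PC n"
  with endo_poisson_endomorphism[OF assms]
  have bij: "bij_betw (subst endo_var) (poisson_carrier n) (poisson_carrier n)"
    by (auto simp: PC_def algebra_automorphism_def)
  have "Var (Pvar 1) \<in> poisson_carrier n"
    using assms by (intro carrier_Var) auto
  \<comment> \<open>Surjectivity is contradicted: every polynomial in the image takes equal values
    at the two points, whereas \<open>Var (Pvar 1)\<close> takes the values 1 and -1.\<close>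
  with bij obtain f where f: "f \<in> poisson_carrier n" "subst endo_var f = Var (Pvar 1)"
    unfolding bij_betw_def by (metis imageE)
  have "subst (collision_point 1) (subst endo_var f) = subst (collision_point (- 1)) (subst endo_var f)"
    using f(1)
    by (induction rule: carrier_induct)
       (simp_all add: subst_Const subst_Var subst_add subst_mult endo_var_collision)
  then have "Const 1 = Const (- 1)"
    by (simp add: f(2) subst_Var collision_point_def)
  then show False by (simp add: Const_inject)
qed

end
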